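(* Let $s,q,r$ be positive integers and let $T(s,q,r)=[z,\,z^{s-1}x^{q-1}y^{r-1}[x,y]]\in B_2(A_3(\mathbb{Z}))$. Then: 1) The element $T(s,q,r)$ is torsion of order dividing $\gcd(s,q,r)$. 2) If $\gcd(s,q,r)=2$ or $3$, the order of $T(s,q,r)$ is exactly equal to $\gcd(s,q,r)$.
   Context: $A=A_3(\mathbb{Z})$ is the free associative unital ring on generators $x,y,z$. $[a,b]=ab-ba$, $L_1=A$, $L_{k+1}=[A,L_k]$ (the $\mathbb{Z}$-span of commutators), and $B_2(A)=L_2/L_3$. $T(s,q,r)$ denotes the class in $B_2(A)$ of the displayed element of $L_2$. *)

theory Defs
  imports "HOL-Algebra.Multiplicative_Group" "HOL-Algebra.Generated_Groups"
    "HOL-Library.Poly_Mapping"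
begin

text \<open>The monoid of words is written additively, as required by the convolution product of
  \<open>Poly_Mapping\<close>; lists are wrapped because the sum of two words is their concatenation.\<close>

datatype gen = GX | GY | GZ

datatype word = Word (letters: "gen list")

instantiation word :: monoid_add
begin

definition zero_word :: word where
  "0 = Word []"

definition plus_word :: "word \<Rightarrow> word \<Rightarrow> word" where
  "u + v = Word (letters u @ letters v)"

instance
  by standard (simp_all add: zero_word_def plus_word_def)

end

text \<open>The free associative unital ring on three generators is the integral monoid ring of the
  free monoid: finitely supported integer combinations of words.\<close>

type_synonym A3 = "word \<Rightarrow>\<^sub>0 int"

definition varx :: A3 where "varx = Poly_Mapping.single (Word [GX]) 1"
definition vary :: A3 where "vary = Poly_Mapping.single (Word [GY]) 1"
definition varz :: A3 where "varz = Poly_Mapping.single (Word [GZ]) 1"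

definition commutator :: "'a::ring \<Rightarrow> 'a \<Rightarrow> 'a" where
  "commutator a b = a * b - b * a"

definition add_grp :: "'a::ab_group_add set \<Rightarrow> 'a monoid" where
  "add_grp S = \<lparr>carrier = S, monoid.mult = (+), one = 0\<rparr>"

text \<open>The index starts at 1; the value at 0 is a dummy. The integral span of a set is the
  subgroup it generates in the additive group of the ring.\<close>

fun lcs :: "nat \<Rightarrow> 'a::ring set" where
  "lcs 0 = UNIV"
| "lcs (Suc 0) = UNIV"
| "lcs (Suc (Suc k)) = generate (add_grp UNIV) {commutator a b | a b. b \<in> lcs (Suc k)}"

definition B2 :: "'a::ring set monoid" where
  "B2 = add_grp (lcs 2) Mod lcs 3"

definition T :: "nat \<Rightarrow> nat \<Rightarrow> nat \<Rightarrow> A3 set" where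
  "T s q r = lcs 3 #>\<^bsub>add_grp (lcs 2)\<^esub>
     commutator varz (varz ^ (s - 1) * varx ^ (q - 1) * vary ^ (r - 1) * commutator varx vary)"

lemma comm_group_add_grp_UNIV: "comm_group (add_grp (UNIV :: 'a::ab_group_add set))"
  by (rule comm_groupI) (auto simp: add_grp_def ac_simps intro: exI[of _ "- x" for x])

lemma subgroup_lcs: "subgroup (lcs k) (add_grp (UNIV :: 'a::ring set))"
proof -
  interpret comm_group "add_grp (UNIV :: 'a set)" by (rule comm_group_add_grp_UNIV)
  have "subgroup UNIV (add_grp (UNIV :: 'a set))"
    using subgroup_self by (simp add: add_grp_def)
  moreover have "subgroup (generate (add_grp UNIV) S) (add_grp (UNIV :: 'a set))" for S
    by (rule generate_is_subgroup) (simp add: add_grp_def)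
  ultimately show ?thesis
    by (cases k rule: lcs.cases) simp_all
qed

lemma lcs_Suc_subset: "lcs (Suc k) \<subseteq> (lcs k :: 'a::ring set)"
proof (induction k)
  case (Suc k)
  interpret comm_group "add_grp (UNIV :: 'a set)" by (rule comm_group_add_grp_UNIV)
  show ?case
  proof (cases k)
    case (Suc j)
    have "{commutator a b | a b. b \<in> lcs (Suc (Suc j))}
        \<subseteq> {commutator a b | a b :: 'a. b \<in> lcs (Suc j)}"
      using Suc.IH unfolding Suc by blast
    then show ?thesis
      unfolding Suc lcs.simps(3) by (rule mono_generate)
  qed simp
qed simp

lemma comm_group_lcs: "comm_group (add_grp (lcs k :: 'a::ring set))"
proof -
  interpret comm_group "add_grp (UNIV :: 'a set)" by (rule comm_group_add_grp_UNIV)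
  have "group (add_grp (lcs k :: 'a set))"
    using subgroup.subgroup_is_group[OF subgroup_lcs[of k] is_group] by (simp add: add_grp_def)
  then show ?thesis
    by (rule group.group_comm_groupI) (simp add: add_grp_def add.commute)
qed

lemma normal_lcs_3: "lcs 3 \<lhd> add_grp (lcs 2 :: 'a::ring set)"
proof -
  interpret comm_group "add_grp (UNIV :: 'a set)" by (rule comm_group_add_grp_UNIV)
  interpret L2: comm_group "add_grp (lcs 2 :: 'a set)" by (rule comm_group_lcs)
  have "lcs 3 \<subseteq> (lcs 2 :: 'a set)"
    using lcs_Suc_subset[of 2] by simp
  then have "subgroup (lcs 3) (add_grp UNIV\<lparr>carrier := lcs 2 :: 'a set\<rparr>)"
    using subgroup_incl[OF subgroup_lcs subgroup_lcs] by blast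
  then show ?thesis
    by (intro L2.subgroup_imp_normal) (simp add: add_grp_def)
qed

lemma group_B2: "group (B2 :: 'a::ring set monoid)"
  unfolding B2_def by (rule normal.factorgroup_is_group[OF normal_lcs_3])

lemma T_in_B2: "T s q r \<in> carrier B2"
proof -
  have "commutator a b \<in> lcs 2" for a b :: A3
    by (auto simp: numeral_2_eq_2 intro!: generate.incl)
  then show ?thesis
    by (auto simp: B2_def T_def carrier_FactGroup add_grp_def)
qed

end

theory Submission
  imports Defs
begin

text \<open>
  Write \<open>t\<close> for the commutator whose class is \<open>T s q r\<close>.

  Upper bound. Modulo \<open>lcs 3\<close> the commutator \<open>[a, b]\<close> depends only on the classes of \<open>a\<close> and \<open>b\<close>
  modulo \<open>lcs 2\<close>, so products inside it may be rotated cyclically, and \<open>[a^n, w]\<close> equals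
  \<open>n [a, a^(n-1) w]\<close> (\<open>commutator_power\<close>). An explicit identity shows that \<open>[a, w [a, b]]\<close> vanishes
  (\<open>commutator_alternating\<close>); polarising, \<open>[a, w [b, c]]\<close> is alternating in \<open>a\<close>, \<open>b\<close>, \<open>c\<close>.
  Hence \<open>t\<close> can be rewritten with any of the three variables outside, and multiplying it by
  that variable's exponent gives \<open>[z^s, x^(q-1) y^(r-1) [x, y]]\<close> or one of its two analogues up
  to sign. Rotating the alternating expression further, with \<open>z^s\<close> absorbed into one argument,
  turns this into a commutator with an element of \<open>lcs 2\<close> (\<open>commutator_two_variable_form\<close>). So
  \<open>s\<close>, \<open>q\<close> and \<open>r\<close> all annihilate the class.

  Lower bound. It suffices to find an additive functional to the integers that is divisible by
  \<open>p\<close> on \<open>lcs 3\<close> but not at \<open>t\<close>, for \<open>p\<close> the greatest common divisor. Conceptually, a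
  polynomial \<open>f\<close> bracketed with a 2-form \<open>\<omega>\<close> should give the class of \<open>df \<and> \<omega>\<close> in the third
  de Rham cohomology of affine 3-space over the integers, which is cyclic of order
  \<open>gcd s (gcd q r)\<close> in degree \<open>(q, r, s)\<close>. The 2-form part of a word records how often one letter
  precedes another, so on words \<open>u\<close>, \<open>v\<close> the desired value of the functional at \<open>[u, v]\<close> is
  bilinear in letter counts of \<open>u\<close> and counts of scattered two-letter subwords of \<open>v\<close>, up to terms
  depending only on \<open>u\<close>. Replacing \<open>v\<close> by \<open>[b, c]\<close> yields the determinant of the degrees of \<open>u\<close>,
  \<open>b\<close>, \<open>c\<close>, which is divisible by \<open>p\<close> because the degrees add up to zero modulo \<open>p\<close>
  (\<open>determinant_dvd\<close>). That is exactly the vanishing on \<open>lcs 3\<close>.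

  Modulo 3 such a functional is a difference of two counts of scattered three-letter subwords
  (\<open>mod_3_functional\<close>). Modulo 2 the counts of three-letter subwords give only two of the three
  terms of the determinant. The missing term comes from a potential on rotation classes of words
  (\<open>rotation_potential\<close>), which exists because words with a nontrivial rotational symmetry are
  proper powers, and for \<open>p = 2\<close> these are only squares (\<open>mod_2_potential\<close>).
\<close>

section \<open>Commutators modulo the third term of the lower central series\<close>

lemma inv_add_grp: "inv\<^bsub>add_grp UNIV\<^esub> b = - b" for b :: "'a::ab_group_add"
proof -
  interpret G: comm_group "add_grp (UNIV :: 'a set)" by (rule comm_group_add_grp_UNIV)
  show ?thesis
    by (rule G.inv_equality) (auto simp: add_grp_def)
qed

lemma lcs_0: "0 \<in> lcs k"
  using subgroup.one_closed[OF subgroup_lcs[of k]] by (simp add: add_grp_def)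

lemma lcs_add: "a \<in> lcs k \<Longrightarrow> b \<in> lcs k \<Longrightarrow> a + b \<in> lcs k"
  using subgroup.m_closed[OF subgroup_lcs[of k]] by (simp add: add_grp_def)

lemma lcs_uminus: "a \<in> lcs k \<Longrightarrow> - a \<in> lcs k"
  using subgroup.m_inv_closed[OF subgroup_lcs[of k]] by (simp add: inv_add_grp)

lemma lcs_diff: "a \<in> lcs k \<Longrightarrow> b \<in> lcs k \<Longrightarrow> a - b \<in> lcs k"
  using lcs_add[of a k "- b"] lcs_uminus[of b k] by simp

lemma lcs_of_nat_mult: "a \<in> lcs k \<Longrightarrow> of_nat n * a \<in> lcs k" for a :: "'a::ring_1"
  by (induction n) (auto simp: lcs_0 distrib_right intro: lcs_add)

lemma lcs_Suc_induct [consumes 1, case_names zero commutator diff]: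
  assumes "x \<in> lcs (Suc (Suc k))"
    and "P 0" and "\<And>a b. b \<in> lcs (Suc k) \<Longrightarrow> P (commutator a b)"
    and "\<And>a b. P a \<Longrightarrow> P b \<Longrightarrow> P (a - b)"
  shows "P (x :: 'a::ring)"
proof -
  have minus: "P (- b)" if "P b" for b
    using assms(4)[OF assms(2) that] by simp
  from assms(1) have "x \<in> generate (add_grp UNIV) {commutator a b | a b. b \<in> lcs (Suc k)}"
    by simp
  then show ?thesis
  proof (induction rule: generate.induct)
    case one
    then show ?case using assms(2) by (simp add: add_grp_def)
  next
    case (incl h)
    then show ?case using assms(3) by auto
  next
    case (inv h)
    then show ?case using assms(3) minus by (auto simp: inv_add_grp)
  next
    case (eng h1 h2)
    then show ?case
      using assms(4)[OF eng.IH(1) minus[OF eng.IH(2)]] by (simp add: add_grp_def)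
  qed
qed

lemma commutator_in_lcs_2: "commutator a b \<in> lcs 2"
  by (auto simp: numeral_2_eq_2 intro!: generate.incl)

lemma commutator_in_lcs_3: "b \<in> lcs 2 \<Longrightarrow> commutator a b \<in> lcs 3"
  by (auto simp: numeral_2_eq_2 numeral_3_eq_3 simp del: lcs.simps(2) intro!: generate.incl)

lemma commutator_in_lcs_3': "a \<in> lcs 2 \<Longrightarrow> commutator a b \<in> lcs 3"
  using lcs_uminus[OF commutator_in_lcs_3[of a b]] by (simp add: commutator_def)

text \<open>The relation is defined on the whole ring, although the quotient by \<open>lcs 3\<close> is of interest only on
  \<open>lcs 2\<close>; this way it can be chained without membership side conditions.\<close>

definition cong3 :: "'a::ring \<Rightarrow> 'a \<Rightarrow> bool" (infix "\<sim>" 50) where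
  "a \<sim> b \<longleftrightarrow> a - b \<in> lcs 3"

lemma cong3_refl [simp]: "a \<sim> a"
  by (simp add: cong3_def lcs_0)

lemma cong3_sym: "a \<sim> b \<Longrightarrow> b \<sim> a"
  using lcs_uminus[of "a - b" 3] by (simp add: cong3_def)

lemma cong3_trans [trans]: "a \<sim> b \<Longrightarrow> b \<sim> c \<Longrightarrow> a \<sim> c"
  using lcs_add[of "a - b" 3 "b - c"] by (simp add: cong3_def)

lemma cong3_add: "a \<sim> b \<Longrightarrow> c \<sim> d \<Longrightarrow> a + c \<sim> b + d"
  using lcs_add[of "a - b" 3 "c - d"] by (simp add: cong3_def algebra_simps)

lemma cong3_of_nat_mult: "a \<sim> b \<Longrightarrow> of_nat n * a \<sim> of_nat n * b" for a b :: "'a::ring_1"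
  using lcs_of_nat_mult[of "a - b" 3 n] by (simp add: cong3_def right_diff_distrib)

lemma cong3_0_iff: "a \<sim> 0 \<longleftrightarrow> a \<in> lcs 3"
  by (simp add: cong3_def)

lemma commutator_cong3_cyclic: "commutator a (u * v) \<sim> commutator a (v * u)"
  using commutator_in_lcs_3[OF commutator_in_lcs_2[of u v], of a]
  by (simp add: cong3_def commutator_def algebra_simps)

text \<open>The identity in the proof comes from \<open>[ab, c] + [bc, a] + [ca, b] = 0\<close>: subtract its instances for
  the triples \<open>(a, b a, w)\<close> and \<open>(a b, a, w)\<close>. What is left over consists of commutators with a
  commutator as one argument.\<close>

lemma commutator_alternating: "commutator a (w * commutator a b) \<in> lcs 3"
proof -
  have "commutator a (w * commutator a b) = commutator (commutator a w) (a * b)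
      + commutator (w * a) (commutator a b) - commutator a (commutator w (b * a))"
    by (simp add: commutator_def algebra_simps)
  then show ?thesis
    by (simp add: lcs_add lcs_diff commutator_in_lcs_2 commutator_in_lcs_3 commutator_in_lcs_3')
qed

text \<open>Polarisation of \<open>commutator_alternating\<close>: the expression changes sign when \<open>a\<close> and \<open>b\<close> are
  exchanged, and likewise for \<open>b\<close> and \<open>c\<close>, so it is invariant under cyclic shifts.\<close>

lemma commutator_rotate:
  "commutator a (w * commutator b c) \<sim> commutator b (w * commutator c a)"
proof -
  have "commutator a (w * commutator b c) - commutator b (w * commutator c a)
      = commutator (a + b) (w * commutator (a + b) c)
        - commutator a (w * commutator a c) - commutator b (w * commutator b c)"
    by (simp add: commutator_def algebra_simps)
  then show ?thesis
    unfolding cong3_def by (simp only: lcs_diff commutator_alternating)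
qed

text \<open>The analogue of \<open>d(a^(n+1)) = (n+1) a^n da\<close>. The induction splits off one factor by
  \<open>[ab, c] = [a, bc] + [b, ca]\<close>.\<close>

lemma commutator_power:
  "commutator (a ^ Suc n) w \<sim> of_nat (Suc n) * commutator a (a ^ n * w)" for a :: "'a::ring_1"
proof (induction n arbitrary: w)
  case (Suc n)
  have "commutator (a ^ Suc (Suc n)) w
      = commutator a (a ^ Suc n * w) + commutator (a ^ Suc n) (w * a)"
    by (simp add: commutator_def algebra_simps power_commutes)
  also have "\<dots> \<sim> commutator a (a ^ Suc n * w)
      + of_nat (Suc n) * commutator a ((a ^ n * w) * a)"
    using Suc.IH[of "w * a"] by (intro cong3_add) (simp_all add: mult.assoc)
  also have "\<dots> \<sim> commutator a (a ^ Suc n * w)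
      + of_nat (Suc n) * commutator a (a * (a ^ n * w))"
    by (intro cong3_add cong3_of_nat_mult commutator_cong3_cyclic) simp
  also have "\<dots> = of_nat (Suc (Suc n)) * commutator a (a ^ Suc n * w)"
    by (simp add: algebra_simps)
  finally show ?case .
qed simp

text \<open>The powers of \<open>b\<close> and \<open>c\<close> can be pulled into an inner commutator as soon as that commutator
  contains the same variable. Two cyclic shifts of the outer expression bring first \<open>c\<close> and then
  \<open>b\<close> into position.\<close>

lemma commutator_two_variable_form:
  "commutator h (b ^ i * c ^ j * commutator b c) \<in> lcs 3" for h b c :: "'a::ring_1"
proof -
  have "commutator h (b ^ i * c ^ j * commutator b c)
      \<sim> commutator b (b ^ i * c ^ j * commutator c h)"
    by (rule commutator_rotate)
  also have "\<dots> = commutator b (b ^ i * commutator c (c ^ j * h))"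
    by (simp add: commutator_def algebra_simps power_commutes)
      (simp add: mult.assoc[symmetric] power_commutes)
  also have "\<dots> \<sim> commutator c (b ^ i * commutator (c ^ j * h) b)"
    by (rule commutator_rotate)
  also have "\<dots> = commutator c (commutator (b ^ i * (c ^ j * h)) b)"
    by (simp add: commutator_def algebra_simps power_commutes)
      (simp add: mult.assoc[symmetric] power_commutes)
  also have "\<dots> \<sim> 0"
    by (simp add: cong3_0_iff commutator_in_lcs_2 commutator_in_lcs_3)
  finally show ?thesis
    by (simp add: cong3_0_iff)
qed

text \<open>Cyclic shifts put \<open>z\<close>, \<open>x\<close> or \<open>y\<close> outside; the exponent of that variable then turns the
  expression into a commutator with a power, to which \<open>commutator_two_variable_form\<close> applies.\<close>

lemma commutator_monomial_torsion:
  fixes x y z :: "'a::ring_1" and i j k :: nat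
  defines "t \<equiv> commutator z (z ^ k * x ^ i * y ^ j * commutator x y)"
  shows "of_nat (Suc k) * t \<in> lcs 3" "of_nat (Suc i) * t \<in> lcs 3" "of_nat (Suc j) * t \<in> lcs 3"
proof -
  have "of_nat (Suc k) * t = of_nat (Suc k) * commutator z (z ^ k * (x ^ i * y ^ j * commutator x y))"
    by (simp add: t_def mult.assoc)
  also have "\<dots> \<sim> commutator (z ^ Suc k) (x ^ i * y ^ j * commutator x y)"
    by (rule cong3_sym[OF commutator_power])
  also have "\<dots> \<sim> 0"
    using commutator_two_variable_form by (simp add: cong3_0_iff)
  finally show "of_nat (Suc k) * t \<in> lcs 3"
    by (simp add: cong3_0_iff)
next
  have t: "t \<sim> commutator x (z ^ k * (x ^ i * (y ^ j * commutator y z)))"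
    using commutator_rotate[of z "z ^ k * x ^ i * y ^ j" x y] by (simp add: t_def mult.assoc)
  also have "\<dots> \<sim> commutator x (x ^ i * (y ^ j * commutator y z * z ^ k))"
    using commutator_cong3_cyclic[of x "z ^ k" "x ^ i * (y ^ j * commutator y z)"]
    by (simp add: mult.assoc)
  finally have "of_nat (Suc i) * t \<sim> of_nat (Suc i) * commutator x (x ^ i * (y ^ j * commutator y z * z ^ k))"
    by (rule cong3_of_nat_mult)
  also have "\<dots> \<sim> commutator (x ^ Suc i) (y ^ j * commutator y z * z ^ k)"
    by (rule cong3_sym[OF commutator_power])
  also have "\<dots> \<sim> commutator (x ^ Suc i) (z ^ k * (y ^ j * commutator y z))"
    by (rule commutator_cong3_cyclic)
  also have "\<dots> = - commutator (x ^ Suc i) (z ^ k * y ^ j * commutator z y)"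
    by (simp add: commutator_def algebra_simps del: power_Suc)
  also have "\<dots> \<sim> 0"
    by (simp only: cong3_0_iff lcs_uminus commutator_two_variable_form)
  finally show "of_nat (Suc i) * t \<in> lcs 3"
    by (simp add: cong3_0_iff)
next
  have "t \<sim> commutator x (z ^ k * x ^ i * y ^ j * commutator y z)"
    using commutator_rotate[of z "z ^ k * x ^ i * y ^ j" x y] by (simp add: t_def)
  also have "\<dots> \<sim> commutator y (z ^ k * x ^ i * y ^ j * commutator z x)"
    by (rule commutator_rotate)
  also have "\<dots> = commutator y ((z ^ k * x ^ i) * (y ^ j * commutator z x))"
    by (simp add: mult.assoc)
  also have "\<dots> \<sim> commutator y ((y ^ j * commutator z x) * (z ^ k * x ^ i))"
    by (rule commutator_cong3_cyclic)
  also have "\<dots> = commutator y (y ^ j * (commutator z x * (z ^ k * x ^ i)))"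
    by (simp add: mult.assoc)
  finally have "of_nat (Suc j) * t
      \<sim> of_nat (Suc j) * commutator y (y ^ j * (commutator z x * (z ^ k * x ^ i)))"
    by (rule cong3_of_nat_mult)
  also have "\<dots> \<sim> commutator (y ^ Suc j) (commutator z x * (z ^ k * x ^ i))"
    by (rule cong3_sym[OF commutator_power])
  also have "\<dots> \<sim> commutator (y ^ Suc j) (z ^ k * x ^ i * commutator z x)"
    by (rule commutator_cong3_cyclic)
  also have "\<dots> \<sim> 0"
    by (simp only: cong3_0_iff commutator_two_variable_form)
  finally show "of_nat (Suc j) * t \<in> lcs 3"
    by (simp add: cong3_0_iff)
qed

section \<open>Orders of classes\<close>

lemma nat_pow_add_grp: "a [^]\<^bsub>add_grp S\<^esub> n = of_nat n * a" for a :: "'a::ring_1"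
  by (induction n) (simp_all add: add_grp_def nat_pow_def algebra_simps)

lemma lcs_3_class_pow_eq_one_iff:
  fixes a :: "'a::ring_1"
  assumes "a \<in> lcs 2"
  shows "(lcs 3 #>\<^bsub>add_grp (lcs 2)\<^esub> a) [^]\<^bsub>B2\<^esub> n = \<one>\<^bsub>B2\<^esub> \<longleftrightarrow> of_nat n * a \<in> lcs 3"
proof -
  interpret N: normal "lcs 3" "add_grp (lcs 2 :: 'a set)" by (rule normal_lcs_3)
  have car: "carrier (add_grp (lcs 2 :: 'a set)) = lcs 2"
    by (simp add: add_grp_def)
  have "(lcs 3 #>\<^bsub>add_grp (lcs 2)\<^esub> a) [^]\<^bsub>B2\<^esub> n = lcs 3 #>\<^bsub>add_grp (lcs 2)\<^esub> (of_nat n * a)"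
    unfolding B2_def using N.FactGroup_pow[of a n] assms by (simp add: nat_pow_add_grp car)
  moreover have "lcs 3 #>\<^bsub>add_grp (lcs 2)\<^esub> b = lcs 3 \<longleftrightarrow> b \<in> lcs 3" if "b \<in> lcs 2" for b :: 'a
    using N.coset_join1[of "lcs 3" b] N.coset_join2[of b "lcs 3"] that N.subgroup_axioms N.subset
      N.rcos_self[of b "lcs 3"] by (auto simp: car)
  ultimately show ?thesis
    using lcs_of_nat_mult[OF assms] by (simp add: B2_def FactGroup_def)
qed

section \<open>Linear functionals on the free ring\<close>

text \<open>The linear extension of \<open>F\<close> from words to the free ring, obtained by identifying the integers with
  the free abelian group on one generator, so that the laws of \<open>frag_extend\<close> apply.\<close>

definition word_functional :: "(gen list \<Rightarrow> int) \<Rightarrow> A3 \<Rightarrow> int" where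
  "word_functional F p =
    poly_mapping.lookup (frag_extend (\<lambda>w. frag_cmul (F (letters w)) (frag_of ())) p) ()"

lemma word_functional_word [simp]: "word_functional F (frag_of (Word w)) = F w"
  by (simp add: word_functional_def)

lemma word_functional_diff: "word_functional F (a - b) = word_functional F a - word_functional F b"
  by (simp add: word_functional_def frag_extend_diff lookup_minus)

lemma word_functional_0 [simp]: "word_functional F 0 = 0"
  by (simp add: word_functional_def)

lemma word_times_word: "frag_of (Word u) * frag_of (Word v) = (frag_of (Word (u @ v)) :: A3)"
  by (simp add: mult_single plus_word_def)

lemma A3_induct [case_names zero word diff]:
  assumes "P (0 :: A3)" "\<And>w. P (frag_of (Word w))" "\<And>a b. P a \<Longrightarrow> P b \<Longrightarrow> P (a - b)"
  shows "P a"
proof (rule frag_induction[where S = UNIV])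
  show "P (frag_of w)" for w
    using assms(2) by (cases w) simp
qed (use assms in auto)

lemma commutator_diff_left: "commutator (a - b) c = commutator a c - commutator b c"
  and commutator_diff_right: "commutator c (a - b) = commutator c a - commutator c b"
  by (simp_all add: commutator_def algebra_simps)

lemma commutator_0 [simp]: "commutator 0 c = 0" "commutator c 0 = 0"
  by (simp_all add: commutator_def)

text \<open>The value at \<open>[u, [b, c]]\<close> of the linear extension of \<open>F\<close>.\<close>

definition triple_defect :: "('a list \<Rightarrow> int) \<Rightarrow> 'a list \<Rightarrow> 'a list \<Rightarrow> 'a list \<Rightarrow> int" where
  "triple_defect F u b c = F (u @ b @ c) - F (b @ c @ u) - F (u @ c @ b) + F (c @ b @ u)"

text \<open>Since \<open>lcs 3\<close> is spanned by double commutators, which are trilinear, only those of words have to be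
  tested.\<close>

lemma word_functional_lcs_3:
  assumes F: "\<And>u b c. m dvd triple_defect F u b c" and a: "a \<in> lcs 3"
  shows "m dvd word_functional F a"
proof -
  have words: "m dvd word_functional F (commutator (frag_of (Word u))
      (commutator (frag_of (Word b)) (frag_of (Word c))))" for u b c
  proof -
    have "word_functional F (commutator (frag_of (Word u))
        (commutator (frag_of (Word b)) (frag_of (Word c)))) = triple_defect F u b c"
      by (simp add: commutator_def right_diff_distrib left_diff_distrib word_times_word
          word_functional_diff triple_defect_def)
    then show ?thesis
      using F by simp
  qed
  have "m dvd word_functional F (commutator (frag_of (Word u)) (commutator (frag_of (Word b)) c))"
    for u b c
    by (induction c rule: A3_induct) (simp_all add: words commutator_diff_right word_functional_diff)
  then have "m dvd word_functional F (commutator (frag_of (Word u)) (commutator b c))" for u b c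
    by (induction b rule: A3_induct)
      (simp_all add: commutator_diff_left commutator_diff_right word_functional_diff)
  then have double: "m dvd word_functional F (commutator p (commutator b c))" for p b c
    by (induction p rule: A3_induct) (simp_all add: commutator_diff_left word_functional_diff)
  have "a \<in> lcs (Suc (Suc 1))"
    using a by (simp only: numeral_3_eq_3 One_nat_def)
  then show ?thesis
  proof (induction rule: lcs_Suc_induct)
    case (commutator p b)
    then have "b \<in> lcs (Suc (Suc 0))" by simp
    then show ?case
      by (induction rule: lcs_Suc_induct)
        (simp_all add: double commutator_diff_right word_functional_diff)
  qed (simp_all add: word_functional_diff)
qed

section \<open>Counting scattered subwords\<close>

fun subword_count :: "'a list \<Rightarrow> 'a list \<Rightarrow> int" where
  "subword_count [] w = 1"
| "subword_count (a # p) [] = 0"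
| "subword_count (a # p) (b # w) = subword_count (a # p) w + (if a = b then subword_count p w else 0)"

lemma subword_count_append_1:
  "subword_count [a] (u @ v) = subword_count [a] u + subword_count [a] v"
  by (induction u) auto

lemma subword_count_append_2:
  "subword_count [a, b] (u @ v) = subword_count [a, b] u
    + subword_count [a] u * subword_count [b] v + subword_count [a, b] v"
  by (induction u) (auto simp: subword_count_append_1 algebra_simps)

lemma subword_count_append_3:
  "subword_count [a, b, c] (u @ v) = subword_count [a, b, c] u
    + subword_count [a, b] u * subword_count [c] v
    + subword_count [a] u * subword_count [b, c] v + subword_count [a, b, c] v"
  by (induction u) (auto simp: subword_count_append_2 algebra_simps)

lemmas subword_count_append =
  subword_count_append_1 subword_count_append_2 subword_count_append_3

lemma subword_count_replicate: "subword_count [a] (replicate n b) = (if a = b then int n else 0)"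
  by (induction n) auto

lemma subword_count_concat_replicate:
  "subword_count [a] (concat (replicate n w)) = int n * subword_count [a] w"
  by (induction n) (auto simp: subword_count_append_1 algebra_simps)

text \<open>The coefficient of the 2-form of letters \<open>i\<close>, \<open>j\<close> in the commutator of \<open>b\<close> and \<open>c\<close>: by
  \<open>subword_count_append_2\<close>, the amount by which the number of scattered subwords \<open>i j\<close> drops when
  \<open>b @ c\<close> is replaced by \<open>c @ b\<close>.\<close>

definition area :: "'a \<Rightarrow> 'a \<Rightarrow> 'a list \<Rightarrow> 'a list \<Rightarrow> int" where
  "area i j b c = subword_count [i] b * subword_count [j] c - subword_count [i] c * subword_count [j] b"

lemma triple_defect_subword_count:
  "triple_defect (subword_count [i, j, k]) u b c
    = subword_count [i] u * area j k b c - subword_count [k] u * area i j b c"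
  by (simp add: triple_defect_def area_def subword_count_append algebra_simps)

text \<open>The expression is the determinant of the degrees of \<open>u\<close>, \<open>b\<close>, \<open>c\<close>, expanded along the row of \<open>u\<close>.
  Adding the other two rows to that row makes all its entries divisible by \<open>m\<close>.\<close>

lemma determinant_dvd:
  assumes "\<And>i. m dvd subword_count [i] (u @ b @ c)"
  shows "m dvd subword_count [i] u * area j k b c + subword_count [j] u * area k i b c
    + subword_count [k] u * area i j b c"
proof -
  have "subword_count [i] u * area j k b c + subword_count [j] u * area k i b c
      + subword_count [k] u * area i j b c
    = subword_count [i] (u @ b @ c) * area j k b c + subword_count [j] (u @ b @ c) * area k i b c
      + subword_count [k] (u @ b @ c) * area i j b c"
    by (simp add: area_def subword_count_append algebra_simps)
  then show ?thesis
    by (simp add: assms)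
qed

definition has_degree :: "(gen \<Rightarrow> int) \<Rightarrow> gen list \<Rightarrow> bool" where
  "has_degree d w \<longleftrightarrow> (\<forall>g. subword_count [g] w = d g)"

lemma has_degree_permute:
  "has_degree d (b @ c @ u) \<longleftrightarrow> has_degree d (u @ b @ c)"
  "has_degree d (u @ c @ b) \<longleftrightarrow> has_degree d (u @ b @ c)"
  "has_degree d (c @ b @ u) \<longleftrightarrow> has_degree d (u @ b @ c)"
  "has_degree d (c @ u) \<longleftrightarrow> has_degree d (u @ c)"
  by (simp_all add: has_degree_def subword_count_append_1 algebra_simps)

definition restrict_degree :: "(gen \<Rightarrow> int) \<Rightarrow> (gen list \<Rightarrow> int) \<Rightarrow> gen list \<Rightarrow> int" where
  "restrict_degree d F w = (if has_degree d w then F w else 0)"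

lemma restrict_degree_dvd_triple_defect:
  assumes "\<And>u b c. has_degree d (u @ b @ c) \<Longrightarrow> m dvd triple_defect F u b c"
  shows "m dvd triple_defect (restrict_degree d F) u b c"
  using assms[of u b c]
  by (simp add: triple_defect_def restrict_degree_def has_degree_permute(1)[of d b c u]
      has_degree_permute(2)[of d u c b] has_degree_permute(3)[of d c b u])

section \<open>The functional modulo three\<close>

text \<open>The two counts contribute the determinant except that the \<open>GY\<close> term appears with
  coefficient \<open>-2\<close>, which is \<open>1\<close> modulo 3.\<close>

lemma mod_3_functional:
  assumes "\<And>g. 3 dvd d g"
  shows "3 dvd triple_defect (restrict_degree d
    (\<lambda>w. subword_count [GZ, GX, GY] w - subword_count [GY, GZ, GX] w)) u b c"
proof (rule restrict_degree_dvd_triple_defect)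
  fix u b c assume "has_degree d (u @ b @ c)"
  then have deg: "3 dvd subword_count [i] (u @ b @ c)" for i
    using assms by (simp add: has_degree_def)
  have "triple_defect (\<lambda>w. subword_count [GZ, GX, GY] w - subword_count [GY, GZ, GX] w) u b c
      = triple_defect (subword_count [GZ, GX, GY]) u b c
        - triple_defect (subword_count [GY, GZ, GX]) u b c"
    by (simp add: triple_defect_def)
  also have "\<dots> = (subword_count [GX] u * area GY GZ b c + subword_count [GY] u * area GZ GX b c
      + subword_count [GZ] u * area GX GY b c) - 3 * (subword_count [GY] u * area GZ GX b c)"
    by (simp add: triple_defect_subword_count)
  finally show "3 dvd triple_defect
      (\<lambda>w. subword_count [GZ, GX, GY] w - subword_count [GY, GZ, GX] w) u b c"
    by (simp only: dvd_diff determinant_dvd[OF deg] dvd_triv_left)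
qed

section \<open>Potentials on rotation classes\<close>

text \<open>Along a rotation from \<open>u @ v\<close> to \<open>v @ u\<close> the potential is required to drop by \<open>n u\<close>. As on any
  graph, prescribed increments come from a potential if they sum to zero around every closed path.
  A closed path of rotations either winds around the word, which contributes multiples of the
  total \<open>n w\<close>, or comes from a symmetry \<open>u @ v = v @ u\<close>; the hypotheses say that both contributions
  vanish modulo \<open>m\<close>.\<close>

lemma rotation_potential:
  fixes n :: "'a list \<Rightarrow> int" and m :: int
  assumes add: "\<And>u v. n (u @ v) = n u + n v"
    and rot: "\<And>u v. u @ v \<in> S \<Longrightarrow> v @ u \<in> S"
    and total: "\<And>w. w \<in> S \<Longrightarrow> m dvd n w"
    and period: "\<And>u v. u @ v \<in> S \<Longrightarrow> u @ v = v @ u \<Longrightarrow> m dvd n u"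
  obtains K :: "'a list \<Rightarrow> int"
    where "\<And>u v. u @ v \<in> S \<Longrightarrow> m dvd K (u @ v) - K (v @ u) - n u"
proof -
  \<comment> \<open>\<open>R k w w'\<close>: some rotation takes \<open>w\<close> to \<open>w'\<close> and has weight \<open>k\<close> modulo \<open>m\<close>. A potential is the
    weight of a rotation to an arbitrarily chosen member of the rotation class.\<close>
  define R where "R k w w' \<longleftrightarrow> (\<exists>u v. w = u @ v \<and> w' = v @ u \<and> m dvd k - n u)" for k w w'
  have nil: "n [] = 0"
    using add[of "[]" "[]"] by simp
  have refl: "R 0 w w" for w
    unfolding R_def by (rule exI[of _ "[]"]) (simp add: nil)
  have in_S: "w' \<in> S" if "R k w w'" "w \<in> S" for k w w'
    using that rot by (auto simp: R_def)
  have inverse: "R (- k) w' w" if "R k w w'" "w \<in> S" for k w w'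
  proof -
    from that obtain u v where uv: "w = u @ v" "w' = v @ u" "m dvd k - n u"
      by (auto simp: R_def)
    have "- k - n v = - (k - n u) - n w"
      by (simp add: uv add)
    then have "m dvd - k - n v"
      using uv(3) total[OF that(2)] by (metis dvd_diff dvd_minus_iff)
    then show ?thesis
      using uv unfolding R_def by blast
  qed
  have compose: "R (k + l) w w''" if "R k w w'" "R l w' w''" "w \<in> S" for k l w w' w''
  proof -
    from that obtain u v where uv: "w = u @ v" "w' = v @ u" "m dvd k - n u"
      by (auto simp: R_def)
    from that obtain u' v' where uv': "w' = u' @ v'" "w'' = v' @ u'" "m dvd l - n u'"
      by (auto simp: R_def)
    have sum: "m dvd (k - n u) + (l - n u')"
      using uv(3) uv'(3) by (rule dvd_add)
    have "v @ u = u' @ v'"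
      using uv uv' by simp
    then consider t where "v = u' @ t" "v' = t @ u" | t where "u' = v @ t" "u = t @ v'"
      by (auto simp: append_eq_append_conv2)
    then show ?thesis
    proof cases
      case 1
      have "m dvd k + l - n (u @ u')"
        using sum by (simp add: add algebra_simps)
      moreover have "w = (u @ u') @ t" "w'' = t @ (u @ u')"
        using uv uv' 1 by simp_all
      ultimately show ?thesis
        unfolding R_def by blast
    next
      case 2
      have "k + l - n t = ((k - n u) + (l - n u')) + n w"
        by (simp add: uv add 2)
      then have "m dvd k + l - n t"
        using sum total[OF that(3)] by (metis dvd_add)
      moreover have "w = t @ (v' @ v)" "w'' = (v' @ v) @ t"
        using uv uv' 2 by simp_all
      ultimately show ?thesis
        unfolding R_def by blast
    qed
  qed
  have unique: "m dvd k" if "R k w w" "w \<in> S" for k w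
  proof -
    from that(1) have "\<exists>u v. w = u @ v \<and> w = v @ u \<and> m dvd k - n u"
      by (simp only: R_def)
    then obtain u v where uv: "w = u @ v" "w = v @ u" "m dvd k - n u"
      by blast
    have "u @ v \<in> S" "u @ v = v @ u"
      using that(2) uv(1,2) by metis+
    then have "m dvd n u"
      by (rule period)
    then show ?thesis
      using uv(3) by (metis dvd_add diff_add_cancel)
  qed
  define base where "base w = (SOME b. \<exists>k. R k w b)" for w
  define K where "K w = (SOME k. R k w (base w))" for w
  have K: "R (K w) w (base w)" for w
  proof -
    have "\<exists>k. R k w (base w)"
      unfolding base_def by (rule someI[of _ w]) (use refl in blast)
    then show ?thesis
      unfolding K_def by (rule someI_ex)
  qed
  show thesis
  proof (rule that)
    fix u v assume S: "u @ v \<in> S"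
    then have S': "v @ u \<in> S"
      by (rule rot)
    have step: "R (n u) (u @ v) (v @ u)"
      unfolding R_def by (intro exI[of _ u] exI[of _ v]) simp
    have "(\<exists>k. R k (u @ v) b) \<longleftrightarrow> (\<exists>k. R k (v @ u) b)" for b
      using compose[OF step _ S] compose[OF inverse[OF step S] _ S'] by blast
    then have base: "base (v @ u) = base (u @ v)"
      by (simp add: base_def)
    let ?b = "base (u @ v)"
    have "R (- K (u @ v) + n u + K (v @ u)) ?b ?b"
      using compose[OF compose[OF inverse[OF K S] step] K] in_S[OF K S] base by metis
    then have "m dvd - K (u @ v) + n u + K (v @ u)"
      using unique in_S[OF K S] by blast
    then have "m dvd - (- K (u @ v) + n u + K (v @ u))"
      by (simp only: dvd_minus_iff)
    then show "m dvd K (u @ v) - K (v @ u) - n u"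
      by (simp add: algebra_simps)
  qed
qed

section \<open>The functional modulo two\<close>

text \<open>In degree \<open>2 e\<close> the parity of the number of scattered subwords \<open>GX GZ\<close> is invariant under
  rotation, so \<open>odd_class\<close> is closed under rotation. The hypothesis on \<open>e\<close> says that the greatest common
  divisor of the degree is 2, so a word of this degree with a rotational symmetry is a square
  \<open>t @ t\<close>. Half a rotation of it moves \<open>e GY\<close> letters \<open>GY\<close>, which obstructs the potential if
  \<open>e GY\<close> is odd. Such a square contains, modulo 2, exactly \<open>e GX * e GZ\<close> scattered subwords \<open>GX GZ\<close>;
  the constant \<open>e GX * e GY * e GZ\<close> is chosen to keep all of these squares out of \<open>odd_class\<close>.\<close>

lemma mod_2_potential:
  fixes e :: "gen \<Rightarrow> int"
  defines "odd_class \<equiv> {w. has_degree (\<lambda>g. 2 * e g) w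
    \<and> odd (subword_count [GX, GZ] w + e GX * e GY * e GZ)}"
  assumes gcd: "\<And>k :: int. (\<And>g. k dvd 2 * e g) \<Longrightarrow> k dvd 2"
  obtains K :: "gen list \<Rightarrow> int"
    where "\<And>u v. u @ v \<in> odd_class \<Longrightarrow> even (K (u @ v) - K (v @ u) - subword_count [GY] u)"
proof (rule rotation_potential[of "subword_count [GY]" odd_class 2])
  show "subword_count [GY] (u @ v) = subword_count [GY] u + subword_count [GY] v" for u v
    by (rule subword_count_append_1)
next
  show "2 dvd subword_count [GY] w" if "w \<in> odd_class" for w
    using that by (simp add: odd_class_def has_degree_def)
next
  fix u v assume uv: "u @ v \<in> odd_class"
  then have deg: "subword_count [g] u + subword_count [g] v = 2 * e g" for g
    by (simp add: odd_class_def has_degree_def subword_count_append_1)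
  have v: "subword_count [g] v = 2 * e g - subword_count [g] u" for g
    using deg[of g] by simp
  have "subword_count [GX, GZ] (u @ v) - subword_count [GX, GZ] (v @ u)
      = 2 * (subword_count [GX] u * e GZ - e GX * subword_count [GZ] u)"
    by (simp add: subword_count_append v algebra_simps)
  then have "even (subword_count [GX, GZ] (u @ v) - subword_count [GX, GZ] (v @ u))"
    by simp
  then show "v @ u \<in> odd_class"
    using uv by (auto simp: odd_class_def has_degree_permute)
next
  fix u v assume uv: "u @ v \<in> odd_class" and comm: "u @ v = v @ u"
  obtain i j t where t: "u = concat (replicate i t)" "v = concat (replicate j t)"
    using comm_append_are_replicate[OF comm] by metis
  have deg: "int (i + j) * subword_count [g] t = 2 * e g" for g
    using uv by (simp add: odd_class_def has_degree_def subword_count_append_1 t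
        subword_count_concat_replicate distrib_right)
  have "int (i + j) dvd 2"
    by (rule gcd) (metis deg dvd_triv_left)
  then have "i + j dvd 2"
    by (metis int_dvd_int_iff of_nat_numeral)
  then have "i + j \<in> {1, 2}"
    using dvd_imp_le[of "i + j" 2] by (cases "i + j = 0") auto
  then consider "i = 0" | "j = 0" | "i = 1" "j = 1"
    by fastforce
  then show "2 dvd subword_count [GY] u"
  proof cases
    case 1
    then show ?thesis by (simp add: t)
  next
    case 2
    then show ?thesis
      using deg[of GY] by (simp add: t subword_count_concat_replicate)
  next
    case 3
    then have e: "subword_count [g] t = e g" for g
      using deg[of g] by simp
    have "odd (subword_count [GX, GZ] (t @ t) + e GX * e GY * e GZ)"
      using uv 3 by (simp add: odd_class_def t)
    then have "odd (e GX * e GZ + e GX * e GY * e GZ)"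
      by (simp add: subword_count_append_2 e)
    then show ?thesis
      using 3 by (auto simp: t e)
  qed
qed (use that in blast)

text \<open>Counting scattered subwords \<open>GX GY GZ\<close> produces the \<open>GX\<close> and \<open>GZ\<close> terms of the determinant. The
  correction \<open>H\<close> changes under rotation by \<open>u\<close> by the number of letters \<open>GY\<close> in \<open>u\<close> times the
  parity that defines the odd class; exchanging \<open>b\<close> and \<open>c\<close> alters that parity by
  \<open>area GZ GX b c\<close>, which supplies the \<open>GY\<close> term. Moving a single letter \<open>GZ\<close> leaves \<open>H\<close> unchanged
  modulo 2, so that \<open>H\<close> does not affect the value at the torsion element.\<close>

lemma mod_2_functional:
  fixes e :: "gen \<Rightarrow> int"
  assumes gcd: "\<And>k :: int. (\<And>g. k dvd 2 * e g) \<Longrightarrow> k dvd 2"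
  obtains H :: "gen list \<Rightarrow> int"
    where "\<And>u b c. even (triple_defect
        (restrict_degree (\<lambda>g. 2 * e g) (\<lambda>w. subword_count [GX, GY, GZ] w + H w)) u b c)"
      and "\<And>w. has_degree (\<lambda>g. 2 * e g) (GZ # w) \<Longrightarrow> even (H (GZ # w) - H (w @ [GZ]))"
proof -
  let ?J = "\<lambda>w. subword_count [GX, GZ] w + e GX * e GY * e GZ"
  let ?D = "has_degree (\<lambda>g. 2 * e g)"
  obtain K where K: "\<And>u v. u @ v \<in> {w. ?D w \<and> odd (?J w)} \<Longrightarrow>
      even (K (u @ v) - K (v @ u) - subword_count [GY] u)"
    using mod_2_potential[OF gcd] by blast
  define H where "H w = (if odd (?J w) then K w else 0)" for w
  have H: "even (H (u @ v) - H (v @ u) - subword_count [GY] u * ?J (u @ v))"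
    if deg: "?D (u @ v)" for u v
  proof -
    have v: "subword_count [g] v = 2 * e g - subword_count [g] u" for g
      using deg by (simp add: has_degree_def subword_count_append_1 algebra_simps)
    have "?J (u @ v) - ?J (v @ u) = 2 * (subword_count [GX] u * e GZ - e GX * subword_count [GZ] u)"
      by (simp add: subword_count_append v algebra_simps)
    then have "even (?J (u @ v) - ?J (v @ u))"
      by (metis dvd_triv_left)
    then have J: "odd (?J (v @ u)) \<longleftrightarrow> odd (?J (u @ v))"
      using even_diff[of "?J (u @ v)" "?J (v @ u)"] even_add[of "?J (u @ v)" "?J (v @ u)"] by satx
    show ?thesis
      using K[of u v] deg J by (auto simp: H_def)
  qed
  show thesis
  proof (rule that[of H])
    show "even (H (GZ # w) - H (w @ [GZ]))" if "?D (GZ # w)" for w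
      using H[of "[GZ]" w] that by simp
  next
    fix u b c
    show "even (triple_defect
        (restrict_degree (\<lambda>g. 2 * e g) (\<lambda>w. subword_count [GX, GY, GZ] w + H w)) u b c)"
    proof (rule restrict_degree_dvd_triple_defect)
      fix u b c assume deg: "?D (u @ b @ c)"
      then have deg': "?D (u @ c @ b)"
        by (simp add: has_degree_permute)
      have "even (subword_count [g] (u @ b @ c))" for g
        using deg by (simp add: has_degree_def)
      then have det: "even (subword_count [GX] u * area GY GZ b c + subword_count [GY] u * area GZ GX b c
          + subword_count [GZ] u * area GX GY b c)"
        by (rule determinant_dvd)
      have "?J (u @ b @ c) - ?J (u @ c @ b) = - area GZ GX b c"
        by (simp add: subword_count_append area_def algebra_simps)
      then have J: "subword_count [GY] u * ?J (u @ b @ c) - subword_count [GY] u * ?J (u @ c @ b)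
          = - (subword_count [GY] u * area GZ GX b c)"
        by (metis right_diff_distrib mult_minus_right)
      have combine: "even (x - z + (h - h') - (k - k'))"
        if "even (x + y + z)" "even (h - h' - j)" "even (k - k' - j')" "j - j' = - y"
        for x y z h h' k k' j j' :: int
        using that by presburger
      have "triple_defect (\<lambda>w. subword_count [GX, GY, GZ] w + H w) u b c
          = triple_defect (subword_count [GX, GY, GZ]) u b c
            + (H (u @ b @ c) - H (b @ c @ u)) - (H (u @ c @ b) - H (c @ b @ u))"
        by (simp add: triple_defect_def)
      moreover have "even (H (u @ b @ c) - H ((b @ c) @ u) - subword_count [GY] u * ?J (u @ b @ c))"
        "even (H (u @ c @ b) - H ((c @ b) @ u) - subword_count [GY] u * ?J (u @ c @ b))"
        using H[OF deg] H[OF deg'] by blast+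
      ultimately show "even (triple_defect (\<lambda>w. subword_count [GX, GY, GZ] w + H w) u b c)"
        using combine[OF det _ _ J] by (simp only: triple_defect_subword_count append_assoc)
    qed
  qed
qed

section \<open>The order of the torsion classes\<close>

lemma variable_power:
  "varx ^ n = frag_of (Word (replicate n GX))"
  "vary ^ n = frag_of (Word (replicate n GY))"
  "varz ^ n = frag_of (Word (replicate n GZ))"
proof -
  have "frag_of (Word [g]) ^ n = (frag_of (Word (replicate n g)) :: A3)" for g n
    by (induction n) (simp_all add: word_times_word flip: zero_word_def)
  then show "varx ^ n = frag_of (Word (replicate n GX))"
    "vary ^ n = frag_of (Word (replicate n GY))" "varz ^ n = frag_of (Word (replicate n GZ))"
    by (simp_all add: varx_def vary_def varz_def)
qed

lemma word_functional_T:
  assumes "w = replicate i GZ @ replicate j GX @ replicate k GY"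
  shows "word_functional F (commutator varz (varz ^ i * varx ^ j * vary ^ k * commutator varx vary))
    = (F (GZ # w @ [GX, GY]) - F ((w @ [GX, GY]) @ [GZ]))
      - (F (GZ # w @ [GY, GX]) - F ((w @ [GY, GX]) @ [GZ]))"
proof -
  have "varz ^ i * varx ^ j * vary ^ k = frag_of (Word w)"
    by (simp add: variable_power word_times_word assms)
  then show ?thesis
    by (simp add: commutator_def varx_def vary_def varz_def right_diff_distrib left_diff_distrib
        word_times_word word_functional_diff)
qed

lemma word_functional_certificate:
  assumes F: "\<And>u b c. int p dvd triple_defect F u b c"
    and w: "w = replicate (s - 1) GZ @ replicate (q - 1) GX @ replicate (r - 1) GY"
    and val: "\<not> int p dvd (F (GZ # w @ [GX, GY]) - F ((w @ [GX, GY]) @ [GZ]))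
      - (F (GZ # w @ [GY, GX]) - F ((w @ [GY, GX]) @ [GZ]))"
  shows "T s q r \<noteq> \<one>\<^bsub>B2\<^esub>"
proof
  interpret G: group "B2 :: A3 set monoid" by (rule group_B2)
  let ?t = "commutator varz (varz ^ (s - 1) * varx ^ (q - 1) * vary ^ (r - 1) * commutator varx vary)"
  assume "T s q r = \<one>\<^bsub>B2\<^esub>"
  then have "T s q r [^]\<^bsub>B2\<^esub> (1 :: nat) = \<one>\<^bsub>B2\<^esub>"
    by simp
  then have "?t \<in> lcs 3"
    unfolding T_def lcs_3_class_pow_eq_one_iff[OF commutator_in_lcs_2] by simp
  from word_functional_lcs_3[OF F this] val show False
    by (simp only: word_functional_T[OF w])
qed

text \<open>Both functionals take the value \<open>1\<close> modulo the respective prime at the commutator defining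
  \<open>T s q r\<close>, up to sign: among its four words, moving \<open>GZ\<close> from one end to the other changes the
  three-letter count by the number of scattered subwords \<open>GX GY\<close>, and this number differs by one
  between \<open>w @ [GX, GY]\<close> and \<open>w @ [GY, GX]\<close>.\<close>

theorem theorem4p1:
  fixes s q r :: nat
  assumes "s > 0" and "q > 0" and "r > 0"
  shows "(0 < group.ord B2 (T s q r) \<and> group.ord B2 (T s q r) dvd gcd s (gcd q r))
    \<and> (gcd s (gcd q r) \<in> {2, 3} \<longrightarrow> group.ord B2 (T s q r) = gcd s (gcd q r))"
proof -
  interpret G: group "B2 :: A3 set monoid" by (rule group_B2)
  let ?g = "gcd s (gcd q r)"
  have "Suc (s - 1) = s" "Suc (q - 1) = q" "Suc (r - 1) = r"
    using assms by simp_all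
  then have "T s q r [^]\<^bsub>B2\<^esub> s = \<one>\<^bsub>B2\<^esub>" "T s q r [^]\<^bsub>B2\<^esub> q = \<one>\<^bsub>B2\<^esub>" "T s q r [^]\<^bsub>B2\<^esub> r = \<one>\<^bsub>B2\<^esub>"
    using commutator_monomial_torsion[where k = "s - 1" and i = "q - 1" and j = "r - 1"
      and x = varx and y = vary and z = varz]
    by (simp_all only: T_def lcs_3_class_pow_eq_one_iff[OF commutator_in_lcs_2])
  then have dvd: "G.ord (T s q r) dvd ?g"
    by (simp add: G.pow_eq_id[OF T_in_B2])
  then have pos: "0 < G.ord (T s q r)"
    using assms by (metis dvd_0_left_iff gcd_eq_0_iff gr0I not_gr_zero)
  define w where "w = replicate (s - 1) GZ @ replicate (q - 1) GX @ replicate (r - 1) GY"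
  define d where "d = (\<lambda>g. case g of GX \<Rightarrow> int q | GY \<Rightarrow> int r | GZ \<Rightarrow> int s)"
  have deg: "has_degree d (GZ # w @ [GX, GY])" "has_degree d ((w @ [GX, GY]) @ [GZ])"
    "has_degree d (GZ # w @ [GY, GX])" "has_degree d ((w @ [GY, GX]) @ [GZ])"
    using assms by (auto simp: has_degree_def d_def w_def subword_count_append_1
        subword_count_replicate split: gen.split)
  have d_dvd: "int ?g dvd d g" for g
    by (cases g) (auto simp: d_def intro: dvd_trans[OF gcd_dvd2])
  have nontrivial: "T s q r \<noteq> \<one>\<^bsub>B2\<^esub>" if "?g = 3"
  proof (rule word_functional_certificate[OF _ w_def])
    show "int 3 dvd triple_defect (restrict_degree d
        (\<lambda>w. subword_count [GZ, GX, GY] w - subword_count [GY, GZ, GX] w)) u b c" for u b c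
      using mod_3_functional[of d] d_dvd that by simp
  qed (simp add: restrict_degree_def deg[simplified] subword_count_append)
  moreover have "T s q r \<noteq> \<one>\<^bsub>B2\<^esub>" if "?g = 2"
  proof -
    define e where "e g = d g div 2" for g
    have "2 dvd d g" for g
      using d_dvd[of g] that by simp
    then have e: "d = (\<lambda>g. 2 * e g)"
      by (simp add: e_def fun_eq_iff)
    have gcd: "k dvd 2" if "\<And>g. k dvd 2 * e g" for k :: int
    proof -
      have "k dvd d g" for g
        using that by (simp add: e)
      from this[of GX] this[of GY] this[of GZ] have "k dvd int ?g"
        by (simp add: d_def flip: gcd_int_int_eq)
      then show ?thesis
        using \<open>?g = 2\<close> by simp
    qed
    obtain H where H: "\<And>u b c. even (triple_defect
        (restrict_degree d (\<lambda>w. subword_count [GX, GY, GZ] w + H w)) u b c)"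
      "\<And>w. has_degree d (GZ # w) \<Longrightarrow> even (H (GZ # w) - H (w @ [GZ]))"
      using mod_2_functional[OF gcd] unfolding e by blast
    show ?thesis
    proof (rule word_functional_certificate[OF _ w_def])
      show "int 2 dvd triple_defect
          (restrict_degree d (\<lambda>w. subword_count [GX, GY, GZ] w + H w)) u b c" for u b c
        using H(1) by simp
      show "\<not> int 2 dvd (restrict_degree d (\<lambda>w. subword_count [GX, GY, GZ] w + H w) (GZ # w @ [GX, GY])
          - restrict_degree d (\<lambda>w. subword_count [GX, GY, GZ] w + H w) ((w @ [GX, GY]) @ [GZ]))
        - (restrict_degree d (\<lambda>w. subword_count [GX, GY, GZ] w + H w) (GZ # w @ [GY, GX])
          - restrict_degree d (\<lambda>w. subword_count [GX, GY, GZ] w + H w) ((w @ [GY, GX]) @ [GZ]))"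
        using H(2)[OF deg(1)] H(2)[OF deg(3)]
        by (simp add: restrict_degree_def deg[simplified] subword_count_append)
    qed
  qed
  ultimately have "?g \<in> {2, 3} \<longrightarrow> G.ord (T s q r) \<noteq> 1"
    using G.ord_eq_1[OF T_in_B2] by blast
  moreover have "n = p" if "n dvd p" "n \<noteq> 1" "p \<in> {2, 3}" for n p :: nat
  proof -
    have "n \<le> p" "n \<noteq> 0"
      using that by (auto dest: dvd_imp_le intro: Nat.gr0I)
    then have "n \<in> {2, 3}"
      using that by auto
    then show ?thesis
      using that by auto
  qed
  ultimately show ?thesis
    using dvd pos by blast
qed

end
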